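(* Let $r,d$ be positive integers, let $\mathcal{I}=\mathcal{I}_1\times\dots\times\mathcal{I}_d$ with finite index sets $\mathcal{I}_\mu$, and let $\mathcal{B}=\sum_{\nu=1}^r\bigotimes_{\mu=1}^d B^{(\nu)}(\mu)\in\mathbb{R}^{\mathcal{I}\times\mathcal{I}}$ with $B^{(\nu)}(\mu)\in\mathbb{R}^{\mathcal{I}_\mu\times\mathcal{I}_\mu}$ be a CP operator with spectrum $\sigma(\mathrm{diag}(\mathcal{B}))\subseteq[1,R]$ for some $1<R\le\infty$. Assume further that the diagonals of all $B^{(\nu)}(\mu)$ with $\nu\ne\mu$ are constant, with $$\mathrm{diag}\left(B^{(\nu)}(\mu)\right)=b_{\nu,\mu}\cdot\mathrm{Id}\qquad\text{for all }\nu\neq\mu.$$ Then for any $k\in\mathbb{N}$ and weights $\alpha_m,\beta_m>0$ $(m=1,\dots,k)$ of the best exponential sum approximation of $1/x$ on $[1,R]$, the approximation $$E_k^*(\mathrm{diag}(\mathcal{B})):=\begin{cases}\displaystyle\sum_{m=1}^k\alpha_m\bigotimes_{\nu=1}^r\exp\left(-\beta_mH^{(\nu)}\right)\otimes\bigotimes_{\nu=r+1}^d\mathrm{Id}&\text{if }r<d,\\ \displaystyle\sum_{m=1}^k\alpha_m\bigotimes_{\nu=1}^d\exp\left(-\beta_mH^{(\nu)}\right)&\text{otherwise,}\end{cases}$$ with $H^{(\nu)}:=\Big(\prod_{j=1,\,j\ne\nu}^d b_{\nu,j}\Big)\,\mathrm{diag}\left(B^{(\nu)}(\nu)\right)$,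 fulfills $$\left\lVert\left(\mathrm{diag}(\mathcal{B})\right)^{-1}-E_k^*(\mathrm{diag}(\mathcal{B}))\right\rVert_2\le\epsilon_{[1,R]}(k).$$
   Context: $\mathrm{diag}(\cdot)$ of a matrix is its diagonal part, $\sigma(\cdot)$ the spectrum, $\lVert\cdot\rVert_2$ the spectral norm, $\exp$ the matrix exponential. If $R=\infty$, $[1,R]$ means $[1,\infty)$. For $k\in\mathbb{N}$, $$\epsilon_{[1,R]}(k)=\min_{E_k}\ \sup_{x\in[1,R]}\left|\tfrac1x-E_k(x)\right|,$$ the minimum being over exponential sums $E_k(x)=\sum_{m=1}^k\alpha_m\exp(-\beta_mx)$ with weights $\alpha_m,\beta_m>0$. The weights $\alpha_m,\beta_m$ in the claim are ones for which this minimum is attained (their existence is taken as known).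
   Formalization: The formal theorem assumes r ≤ d; for r > d the claim fails, since E_k^* omits the terms ν > d (e.g. d=1, r=2, k=1, B^(1)(1)=(-T), B^(2)(1)=(1+T): diag(B)=1 but E_1^*=α_1 exp(β_1 T) is unbounded in T). *)

theory Defs
  imports "HOL-Analysis.Analysis"
begin

section \<open>Matrices over an arbitrary finite index set\<close>

text \<open>
  A matrix in \<open>\<real>\<^sup>J\<^sup>\<times>\<^sup>J\<close>, for a finite set \<open>J\<close>, is a function on pairs of indices of
  which only the entries in \<open>J \<times> J\<close> are relevant. Operations that depend on the
  index set take it as their first argument.
\<close>

type_synonym 'i rmat = "'i \<Rightarrow> 'i \<Rightarrow> real"

definition mat_id :: "'i rmat" where
  "mat_id i j = (if i = j then 1 else 0)"

definition mat_diff :: "'i rmat \<Rightarrow> 'i rmat \<Rightarrow> 'i rmat" where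
  "mat_diff A C i j = A i j - C i j"

definition mat_scale :: "real \<Rightarrow> 'i rmat \<Rightarrow> 'i rmat" where
  "mat_scale c A i j = c * A i j"

definition mat_mult :: "'i set \<Rightarrow> 'i rmat \<Rightarrow> 'i rmat \<Rightarrow> 'i rmat" where
  "mat_mult J A C i j = (\<Sum>l\<in>J. A i l * C l j)"

definition mat_eq :: "'i set \<Rightarrow> 'i rmat \<Rightarrow> 'i rmat \<Rightarrow> bool" where
  "mat_eq J A C \<longleftrightarrow> (\<forall>i\<in>J. \<forall>j\<in>J. A i j = C i j)"

definition diag_part :: "'i rmat \<Rightarrow> 'i rmat" where
  "diag_part A i j = (if i = j then A i i else 0)"

definition is_mat_inv :: "'i set \<Rightarrow> 'i rmat \<Rightarrow> 'i rmat \<Rightarrow> bool" where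
  "is_mat_inv J A C \<longleftrightarrow> mat_eq J (mat_mult J A C) mat_id \<and> mat_eq J (mat_mult J C A) mat_id"

definition mat_invertible :: "'i set \<Rightarrow> 'i rmat \<Rightarrow> bool" where
  "mat_invertible J A \<longleftrightarrow> (\<exists>C. is_mat_inv J A C)"

text \<open>The entries of the inverse in \<open>J \<times> J\<close> are unique if it exists; the others are unspecified.\<close>

definition mat_inv :: "'i set \<Rightarrow> 'i rmat \<Rightarrow> 'i rmat" where
  "mat_inv J A = (SOME C. is_mat_inv J A C)"

primrec mat_pow :: "'i set \<Rightarrow> 'i rmat \<Rightarrow> nat \<Rightarrow> 'i rmat" where
  "mat_pow J A 0 = mat_id"
| "mat_pow J A (Suc n) = mat_mult J A (mat_pow J A n)"

definition mat_exp :: "'i set \<Rightarrow> 'i rmat \<Rightarrow> 'i rmat" where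
  "mat_exp J A i j = (\<Sum>n. mat_pow J A n i j / fact n)"

text \<open>The spectrum is the set of all complex eigenvalues.\<close>

definition mat_spectrum :: "'i set \<Rightarrow> 'i rmat \<Rightarrow> complex set" where
  "mat_spectrum J A =
     {c. \<exists>v :: 'i \<Rightarrow> complex. (\<exists>i\<in>J. v i \<noteq> 0) \<and>
           (\<forall>i\<in>J. (\<Sum>j\<in>J. complex_of_real (A i j) * v j) = c * v i)}"

text \<open>The operator norm induced by the Euclidean norm \<^const>\<open>L2_set\<close> on \<open>\<real>\<^sup>J\<close>.\<close>

definition spectral_norm :: "'i set \<Rightarrow> 'i rmat \<Rightarrow> real" where
  "spectral_norm J A =
     (SUP v \<in> {v :: 'i \<Rightarrow> real. L2_set v J \<le> 1}. L2_set (\<lambda>i. \<Sum>j\<in>J. A i j * v j) J)"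


section \<open>Tensor products and CP operators\<close>

text \<open>
  \<open>multi_index d I\<close> is \<open>I 1 \<times> \<dots> \<times> I d\<close>, as the set of extensional functions on \<open>{1..d}\<close>.
\<close>

definition multi_index :: "nat \<Rightarrow> (nat \<Rightarrow> 'a set) \<Rightarrow> (nat \<Rightarrow> 'a) set" where
  "multi_index d I = (\<Pi>\<^sub>E \<mu>\<in>{1..d}. I \<mu>)"

definition tensor :: "nat \<Rightarrow> (nat \<Rightarrow> 'a rmat) \<Rightarrow> (nat \<Rightarrow> 'a) rmat" where
  "tensor d A i j = (\<Prod>\<mu>\<in>{1..d}. A \<mu> (i \<mu>) (j \<mu>))"

definition cp_operator :: "nat \<Rightarrow> nat \<Rightarrow> (nat \<Rightarrow> nat \<Rightarrow> 'a rmat) \<Rightarrow> (nat \<Rightarrow> 'a) rmat" where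
  "cp_operator d r B i j = (\<Sum>\<nu>\<in>{1..r}. tensor d (B \<nu>) i j)"


section \<open>Best approximation of the reciprocal by exponential sums\<close>

text \<open>\<open>one_to R\<close> is the real interval \<open>[1, R]\<close>, which is \<open>[1, \<infinity>)\<close> if \<open>R = \<infinity>\<close>.\<close>

definition one_to :: "ereal \<Rightarrow> real set" where
  "one_to R = {x. 1 \<le> x \<and> ereal x \<le> R}"

definition exp_sum :: "nat \<Rightarrow> (nat \<Rightarrow> real) \<Rightarrow> (nat \<Rightarrow> real) \<Rightarrow> real \<Rightarrow> real" where
  "exp_sum k \<alpha> \<beta> x = (\<Sum>m\<in>{1..k}. \<alpha> m * exp (- \<beta> m * x))"

definition pos_weights :: "nat \<Rightarrow> ((nat \<Rightarrow> real) \<times> (nat \<Rightarrow> real)) set" where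
  "pos_weights k = {(\<alpha>, \<beta>). \<forall>m\<in>{1..k}. \<alpha> m > 0 \<and> \<beta> m > 0}"

text \<open>
  The set of errors in the supremum below is bounded for weights in \<^const>\<open>pos_weights\<close>,
  even if \<open>R = \<infinity>\<close>, so the real-valued supremum is the genuine one.
\<close>

definition exp_sum_error :: "ereal \<Rightarrow> nat \<Rightarrow> (nat \<Rightarrow> real) \<Rightarrow> (nat \<Rightarrow> real) \<Rightarrow> real" where
  "exp_sum_error R k \<alpha> \<beta> = (SUP x \<in> one_to R. \<bar>1 / x - exp_sum k \<alpha> \<beta> x\<bar>)"

definition exp_sum_eps :: "ereal \<Rightarrow> nat \<Rightarrow> real" where
  "exp_sum_eps R k = (INF (\<alpha>, \<beta>) \<in> pos_weights k. exp_sum_error R k \<alpha> \<beta>)"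

text \<open>The infimum \<^const>\<open>exp_sum_eps\<close> is a minimum, attained by the given weights.\<close>

definition best_weights :: "ereal \<Rightarrow> nat \<Rightarrow> (nat \<Rightarrow> real) \<Rightarrow> (nat \<Rightarrow> real) \<Rightarrow> bool" where
  "best_weights R k \<alpha> \<beta> \<longleftrightarrow>
     (\<alpha>, \<beta>) \<in> pos_weights k \<and> exp_sum_error R k \<alpha> \<beta> = exp_sum_eps R k"


section \<open>The approximate inverse\<close>

definition H_mat ::
  "nat \<Rightarrow> (nat \<Rightarrow> nat \<Rightarrow> 'a rmat) \<Rightarrow> (nat \<Rightarrow> nat \<Rightarrow> real) \<Rightarrow> nat \<Rightarrow> 'a rmat" where
  "H_mat d B b \<nu> = mat_scale (\<Prod>j\<in>{1..d} - {\<nu>}. b \<nu> j) (diag_part (B \<nu> \<nu>))"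

definition E_star ::
  "nat \<Rightarrow> nat \<Rightarrow> (nat \<Rightarrow> 'a set) \<Rightarrow> (nat \<Rightarrow> nat \<Rightarrow> 'a rmat) \<Rightarrow> (nat \<Rightarrow> nat \<Rightarrow> real) \<Rightarrow>
   nat \<Rightarrow> (nat \<Rightarrow> real) \<Rightarrow> (nat \<Rightarrow> real) \<Rightarrow> (nat \<Rightarrow> 'a) rmat" where
  "E_star d r I B b k \<alpha> \<beta> i j =
     (if r < d then
        (\<Sum>m\<in>{1..k}. \<alpha> m * tensor d
           (\<lambda>\<nu>. if \<nu> \<le> r then mat_exp (I \<nu>) (mat_scale (- \<beta> m) (H_mat d B b \<nu>)) else mat_id) i j)
      else
        (\<Sum>m\<in>{1..k}. \<alpha> m * tensor d
           (\<lambda>\<nu>. mat_exp (I \<nu>) (mat_scale (- \<beta> m) (H_mat d B b \<nu>))) i j))"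

end

theory Submission
  imports Defs
begin

text \<open>
  Everything is diagonal. Since the diagonal of \<open>B \<nu> \<mu>\<close> is constant for \<open>\<mu> \<noteq> \<nu>\<close>, the
  diagonal entry of the CP operator at the multi-index \<open>i\<close> is the sum over \<open>\<nu> \<le> r\<close> of the
  entries of \<open>H \<nu>\<close> at \<open>i \<nu>\<close>. The exponential of this sum is the product of the exponentials,
  so the approximate inverse is the exponential sum evaluated at the diagonal, and the error at
  each entry is the scalar approximation error at an eigenvalue, which lies in \<open>[1, R]\<close>.
\<close>

text \<open>A relation rather than an equation of functions, because entries outside
  \<open>J\<close> are irrelevant and those of \<open>mat_inv\<close> are unspecified there.\<close>

definition diag_on :: "'i set \<Rightarrow> 'i rmat \<Rightarrow> ('i \<Rightarrow> real) \<Rightarrow> bool" where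
  "diag_on J A f \<longleftrightarrow> (\<forall>i\<in>J. \<forall>j\<in>J. A i j = (if i = j then f i else 0))"

lemma diag_onD: "diag_on J A f \<Longrightarrow> i \<in> J \<Longrightarrow> j \<in> J \<Longrightarrow> A i j = (if i = j then f i else 0)"
  by (simp add: diag_on_def)

lemma diag_on_cong:
  assumes "diag_on J A f" "\<And>i. i \<in> J \<Longrightarrow> f i = g i"
  shows "diag_on J A g"
  using assms by (auto simp: diag_on_def)

lemma diag_on_diag_part: "diag_on J (diag_part A) (\<lambda>i. A i i)"
  by (simp add: diag_on_def diag_part_def)

lemma diag_on_mat_id: "diag_on J mat_id (\<lambda>_. 1)"
  by (simp add: diag_on_def mat_id_def)

lemma diag_on_mat_scale: "diag_on J A f \<Longrightarrow> diag_on J (mat_scale c A) (\<lambda>i. c * f i)"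
  by (simp add: diag_on_def mat_scale_def)

lemma diag_on_mat_diff:
  "diag_on J A f \<Longrightarrow> diag_on J C g \<Longrightarrow> diag_on J (mat_diff A C) (\<lambda>i. f i - g i)"
  by (simp add: diag_on_def mat_diff_def)

lemma sum_diag_on:
  assumes "finite J" "diag_on J A f" "i \<in> J"
  shows "(\<Sum>j\<in>J. A i j * v j) = f i * v i"
proof -
  have "(\<Sum>j\<in>J. A i j * v j) = (\<Sum>j\<in>J. if i = j then f j * v j else 0)"
    by (intro sum.cong refl) (simp add: diag_onD[OF assms(2,3)])
  then show ?thesis using assms by simp
qed

lemma diag_on_mat_mult:
  assumes "finite J" "diag_on J A f" "diag_on J C g"
  shows "diag_on J (mat_mult J A C) (\<lambda>i. f i * g i)"
  unfolding diag_on_def mat_mult_def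
  by (intro ballI) (simp add: sum_diag_on[OF assms(1,2)] diag_onD[OF assms(3)])

lemma diag_on_mat_pow:
  assumes "finite J" "diag_on J A f"
  shows "diag_on J (mat_pow J A n) (\<lambda>i. f i ^ n)"
  by (induction n) (simp_all add: diag_on_mat_id diag_on_mat_mult[OF assms])

lemma diag_on_mat_exp:
  assumes "finite J" "diag_on J A f"
  shows "diag_on J (mat_exp J A) (\<lambda>i. exp (f i))"
  unfolding diag_on_def
proof (intro ballI)
  fix i j assume "i \<in> J" "j \<in> J"
  then have "mat_exp J A i j = (\<Sum>n. (if i = j then f i ^ n else 0) / fact n)"
    by (simp add: mat_exp_def diag_onD[OF diag_on_mat_pow[OF assms]])
  then show "mat_exp J A i j = (if i = j then exp (f i) else 0)"
    \<comment> \<open>On the diagonal this is the defining power series of the real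
      \<open>exp\<close>; off the diagonal every term is zero.\<close>
    by (simp add: exp_def scaleR_conv_of_real field_simps)
qed

text \<open>The unit vector at \<open>i\<close> is an eigenvector. This turns the spectral
  hypothesis of the theorem into a statement about diagonal entries.\<close>

lemma diag_on_spectrum:
  assumes "finite J" "diag_on J A f" "i \<in> J"
  shows "complex_of_real (f i) \<in> mat_spectrum J A"
proof -
  let ?v = "\<lambda>j. if j = i then 1 else 0 :: complex"
  have "(\<Sum>j\<in>J. complex_of_real (A l j) * ?v j) = complex_of_real (f i) * ?v l"
    if "l \<in> J" for l
  proof -
    have "(\<Sum>j\<in>J. complex_of_real (A l j) * ?v j) = complex_of_real (A l i)"
      using assms(1,3) by (simp add: if_distrib cong: if_cong)
    then show ?thesis using that by (simp add: diag_onD[OF assms(2) _ assms(3)])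
  qed
  then show ?thesis
    using assms(3) unfolding mat_spectrum_def by (intro CollectI exI[of _ ?v]) auto
qed

lemma diag_on_invertible:
  assumes "finite J" "diag_on J A f" "\<And>i. i \<in> J \<Longrightarrow> f i \<noteq> 0"
  shows "mat_invertible J A"
proof -
  let ?C = "\<lambda>i j. if i = j then 1 / f i else 0"
  have C: "diag_on J ?C (\<lambda>i. 1 / f i)" by (simp add: diag_on_def)
  have "mat_eq J (mat_mult J A ?C) mat_id"
    using assms(3) by (simp add: mat_eq_def mat_id_def diag_onD[OF diag_on_mat_mult[OF assms(1,2) C]])
  moreover have "mat_eq J (mat_mult J ?C A) mat_id"
    using assms(3) by (simp add: mat_eq_def mat_id_def diag_onD[OF diag_on_mat_mult[OF assms(1) C assms(2)]])
  ultimately have "is_mat_inv J A ?C" by (simp add: is_mat_inv_def)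
  then show ?thesis unfolding mat_invertible_def by blast
qed

text \<open>\<open>mat_inv\<close> is a choice, so only its defining property is available. Row
  \<open>i\<close> of the product with \<open>A\<close> is \<open>f i\<close> times row
  \<open>i\<close> of the inverse, and dividing by \<open>f i\<close> fixes all entries in
  \<open>J\<close>.\<close>

lemma diag_on_mat_inv:
  assumes "finite J" "diag_on J A f" "\<And>i. i \<in> J \<Longrightarrow> f i \<noteq> 0"
  shows "diag_on J (mat_inv J A) (\<lambda>i. 1 / f i)"
proof -
  have "is_mat_inv J A (mat_inv J A)"
    using diag_on_invertible[OF assms] unfolding mat_invertible_def mat_inv_def
    by (rule someI_ex)
  then have "mat_eq J (mat_mult J A (mat_inv J A)) mat_id" by (simp add: is_mat_inv_def)
  then have "\<forall>i\<in>J. \<forall>j\<in>J. f i * mat_inv J A i j = (if i = j then 1 else 0)"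
    by (simp add: mat_eq_def mat_mult_def mat_id_def sum_diag_on[OF assms(1,2)])
  then have "f i * mat_inv J A i j = (if i = j then 1 else 0)" if "i \<in> J" "j \<in> J" for i j
    using that by blast
  then show ?thesis
    unfolding diag_on_def using assms(3)
    by (metis divide_eq_0_iff nonzero_mult_div_cancel_left)
qed

text \<open>Coordinate \<open>i\<close> is stretched by \<open>\<bar>f i\<bar>\<close>, hence by at
  most \<open>e\<close>. For empty \<open>J\<close> the bound on \<open>f\<close> is vacuous, which
  is why \<open>0 \<le> e\<close> is assumed separately.\<close>

lemma spectral_norm_diag_on_le:
  assumes "finite J" "diag_on J A f" "0 \<le> e" "\<And>i. i \<in> J \<Longrightarrow> \<bar>f i\<bar> \<le> e"
  shows "spectral_norm J A \<le> e"
  unfolding spectral_norm_def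
proof (rule cSUP_least)
  have "L2_set (\<lambda>_. 0) J \<le> (1::real)" by (simp add: L2_set_def)
  then show "{v :: 'a \<Rightarrow> real. L2_set v J \<le> 1} \<noteq> {}" by blast
next
  fix v :: "'a \<Rightarrow> real" assume "v \<in> {v. L2_set v J \<le> 1}"
  then have v: "L2_set v J \<le> 1" by simp
  have "L2_set (\<lambda>i. \<Sum>j\<in>J. A i j * v j) J = L2_set (\<lambda>i. \<bar>f i * v i\<bar>) J"
    by (simp add: L2_set_def sum_diag_on[OF assms(1,2)])
  also have "\<dots> \<le> L2_set (\<lambda>i. e * \<bar>v i\<bar>) J"
    by (intro L2_set_mono) (auto simp: abs_mult intro!: mult_right_mono assms(4))
  also have "\<dots> = e * L2_set v J"
    using assms(3) by (simp add: L2_set_def power_mult_distrib sum_distrib_left[symmetric] real_sqrt_mult)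
  also have "\<dots> \<le> e" using v assms(3) by (simp add: mult_left_le)
  finally show "L2_set (\<lambda>i. \<Sum>j\<in>J. A i j * v j) J \<le> e" .
qed

lemma finite_multi_index:
  "(\<And>\<mu>. \<mu> \<in> {1..d} \<Longrightarrow> finite (I \<mu>)) \<Longrightarrow> finite (multi_index d I)"
  unfolding multi_index_def by (rule finite_PiE) auto

lemma diag_on_tensor:
  assumes "\<And>\<mu>. \<mu> \<in> {1..d} \<Longrightarrow> diag_on (I \<mu>) (A \<mu>) (f \<mu>)"
  shows "diag_on (multi_index d I) (tensor d A) (\<lambda>i. \<Prod>\<mu>\<in>{1..d}. f \<mu> (i \<mu>))"
  unfolding diag_on_def
proof (intro ballI)
  fix i j assume ij: "i \<in> multi_index d I" "j \<in> multi_index d I"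
  then have "tensor d A i j = (\<Prod>\<mu>\<in>{1..d}. if i \<mu> = j \<mu> then f \<mu> (i \<mu>) else 0)"
    unfolding tensor_def
    by (intro prod.cong refl diag_onD[OF assms]) (auto simp: multi_index_def)
  \<comment> \<open>Multi-indices are extensional, so distinct ones differ at some coordinate in
    \<open>{1..d}\<close>; the factor there is zero.\<close>
  moreover have "\<exists>\<mu>\<in>{1..d}. i \<mu> \<noteq> j \<mu>" if "i \<noteq> j"
    using ij that unfolding multi_index_def by (metis PiE_ext)
  ultimately show "tensor d A i j = (if i = j then \<Prod>\<mu>\<in>{1..d}. f \<mu> (i \<mu>) else 0)"
    by (auto simp: prod_zero_iff)
qed

text \<open>In summand \<open>\<nu>\<close> all factors except the one at position
  \<open>\<nu>\<close> are constants, and their product is the scalar in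
  \<open>H_mat\<close>.\<close>

lemma cp_operator_diagonal:
  assumes "r \<le> d"
    and "\<And>\<nu> \<mu>. \<nu> \<in> {1..r} \<Longrightarrow> \<mu> \<in> {1..d} \<Longrightarrow> \<nu> \<noteq> \<mu> \<Longrightarrow>
           mat_eq (I \<mu>) (diag_part (B \<nu> \<mu>)) (mat_scale (b \<nu> \<mu>) mat_id)"
    and i: "i \<in> multi_index d I"
  shows "cp_operator d r B i i = (\<Sum>\<nu>\<in>{1..r}. H_mat d B b \<nu> (i \<nu>) (i \<nu>))"
  unfolding cp_operator_def
proof (rule sum.cong[OF refl])
  fix \<nu> assume \<nu>: "\<nu> \<in> {1..r}"
  have "B \<nu> \<mu> (i \<mu>) (i \<mu>) = b \<nu> \<mu>" if "\<mu> \<in> {1..d} - {\<nu>}" for \<mu>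
  proof -
    have "i \<mu> \<in> I \<mu>" using i that by (auto simp: multi_index_def)
    then show ?thesis
      using assms(2)[OF \<nu>, of \<mu>] that
      by (fastforce simp: mat_eq_def diag_part_def mat_scale_def mat_id_def)
  qed
  then have "(\<Prod>\<mu>\<in>{1..d} - {\<nu>}. B \<nu> \<mu> (i \<mu>) (i \<mu>)) = (\<Prod>\<mu>\<in>{1..d} - {\<nu>}. b \<nu> \<mu>)"
    by (intro prod.cong refl)
  \<comment> \<open>Here \<open>r \<le> d\<close> enters: position \<open>\<nu>\<close> occurs in
    the tensor product, so its factor can be split off.\<close>
  moreover have "\<nu> \<in> {1..d}" using \<nu> assms(1) by auto
  ultimately show "tensor d (B \<nu>) i i = H_mat d B b \<nu> (i \<nu>) (i \<nu>)"
    by (simp add: tensor_def H_mat_def mat_scale_def diag_part_def prod.remove mult.commute)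
qed

lemma diag_on_E_star:
  assumes "r \<le> d" and "\<And>\<mu>. \<mu> \<in> {1..d} \<Longrightarrow> finite (I \<mu>)"
  shows "diag_on (multi_index d I) (E_star d r I B b k \<alpha> \<beta>)
           (\<lambda>i. exp_sum k \<alpha> \<beta> (\<Sum>\<nu>\<in>{1..r}. H_mat d B b \<nu> (i \<nu>) (i \<nu>)))"
proof -
  define h where "h \<nu> x = H_mat d B b \<nu> x x" for \<nu> x
  define T where "T m = tensor d (\<lambda>\<nu>. if \<nu> \<le> r
      then mat_exp (I \<nu>) (mat_scale (- \<beta> m) (H_mat d B b \<nu>)) else mat_id)" for m
  \<comment> \<open>Both cases of \<open>E_star\<close> have this form: the second one means
    \<open>r = d\<close>, and then \<open>\<nu> \<le> r\<close> holds at every position.\<close>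
  have E: "E_star d r I B b k \<alpha> \<beta> i j = (\<Sum>m\<in>{1..k}. \<alpha> m * T m i j)" for i j
    using assms(1) by (auto simp: E_star_def T_def tensor_def intro!: sum.cong prod.cong)
  have H: "diag_on (I \<nu>) (H_mat d B b \<nu>) (h \<nu>)" for \<nu>
    by (simp add: diag_on_def h_def H_mat_def mat_scale_def diag_part_def)
  have T: "diag_on (multi_index d I) (T m) (\<lambda>i. exp (- \<beta> m * (\<Sum>\<nu>\<in>{1..r}. h \<nu> (i \<nu>))))" for m
  proof -
    have "diag_on (multi_index d I) (T m)
            (\<lambda>i. \<Prod>\<mu>\<in>{1..d}. if \<mu> \<le> r then exp (- \<beta> m * h \<mu> (i \<mu>)) else 1)"
      unfolding T_def
    proof (rule diag_on_tensor)
      fix \<mu> assume "\<mu> \<in> {1..d}"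
      from diag_on_mat_exp[OF assms(2)[OF this] diag_on_mat_scale[OF H, where c = "- \<beta> m"]]
      show "diag_on (I \<mu>)
          (if \<mu> \<le> r then mat_exp (I \<mu>) (mat_scale (- \<beta> m) (H_mat d B b \<mu>)) else mat_id)
          (\<lambda>x. if \<mu> \<le> r then exp (- \<beta> m * h \<mu> x) else 1)"
        by (auto simp: diag_on_mat_id)
    qed
    \<comment> \<open>Positions beyond \<open>r\<close> contribute the factor 1; the remaining
      exponentials multiply to the exponential of the sum.\<close>
    moreover have "(\<Prod>\<mu>\<in>{1..d}. if \<mu> \<le> r then exp (- \<beta> m * h \<mu> (i \<mu>)) else 1)
        = exp (- \<beta> m * (\<Sum>\<nu>\<in>{1..r}. h \<nu> (i \<nu>)))" for i
    proof -
      have "(\<Prod>\<mu>\<in>{1..d}. if \<mu> \<le> r then exp (- \<beta> m * h \<mu> (i \<mu>)) else 1)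
          = (\<Prod>\<mu>\<in>{1..r}. exp (- \<beta> m * h \<mu> (i \<mu>)))"
        using assms(1) by (intro prod.mono_neutral_cong_right) auto
      then show ?thesis by (simp add: exp_sum sum_distrib_left)
    qed
    ultimately show ?thesis by simp
  qed
  show ?thesis
    by (auto simp: diag_on_def E exp_sum_def diag_onD[OF T] h_def)
qed

text \<open>A real supremum bounds its members only if the set is bounded above. For positive
  weights and \<open>y \<ge> 1\<close>, \<open>1 / y\<close> lies between 0 and 1 and the
  exponential sum between 0 and the sum of the \<open>\<alpha> m\<close>, which gives a bound valid
  also for infinite \<open>R\<close>.\<close>

lemma exp_sum_error_upper:
  assumes "(\<alpha>, \<beta>) \<in> pos_weights k" "x \<in> one_to R"
  shows "\<bar>1 / x - exp_sum k \<alpha> \<beta> x\<bar> \<le> exp_sum_error R k \<alpha> \<beta>"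
  unfolding exp_sum_error_def
proof (rule cSUP_upper[OF assms(2)], rule bdd_aboveI2)
  fix y assume "y \<in> one_to R"
  then have y: "1 \<le> y" by (simp add: one_to_def)
  have pos: "\<alpha> m > 0 \<and> \<beta> m > 0" if "m \<in> {1..k}" for m
    using assms(1) that by (auto simp: pos_weights_def)
  have "0 \<le> exp_sum k \<alpha> \<beta> y"
    unfolding exp_sum_def by (intro sum_nonneg) (simp add: pos less_imp_le)
  moreover have "exp_sum k \<alpha> \<beta> y \<le> (\<Sum>m\<in>{1..k}. \<alpha> m)"
    unfolding exp_sum_def using y pos by (intro sum_mono) (simp add: less_imp_le mult_left_le)
  moreover have "0 \<le> 1 / y" "1 / y \<le> 1" using y by simp_all
  ultimately show "\<bar>1 / y - exp_sum k \<alpha> \<beta> y\<bar> \<le> 1 + (\<Sum>m\<in>{1..k}. \<alpha> m)" by linarith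
qed

theorem theorem4p13:
  fixes r d k :: nat
    and I :: "nat \<Rightarrow> 'a set"
    and B :: "nat \<Rightarrow> nat \<Rightarrow> 'a rmat"
    and b :: "nat \<Rightarrow> nat \<Rightarrow> real"
    and R :: ereal
    and \<alpha> \<beta> :: "nat \<Rightarrow> real"
  assumes "1 \<le> r" and "1 \<le> d" and "r \<le> d"
    and "\<And>\<mu>. \<mu> \<in> {1..d} \<Longrightarrow> finite (I \<mu>)"
    and "1 < R"
    and "mat_spectrum (multi_index d I) (diag_part (cp_operator d r B))
           \<subseteq> complex_of_real ` one_to R"
    and "\<And>\<nu> \<mu>. \<nu> \<in> {1..r} \<Longrightarrow> \<mu> \<in> {1..d} \<Longrightarrow> \<nu> \<noteq> \<mu> \<Longrightarrow>
           mat_eq (I \<mu>) (diag_part (B \<nu> \<mu>)) (mat_scale (b \<nu> \<mu>) mat_id)"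
    and "best_weights R k \<alpha> \<beta>"
  shows "mat_invertible (multi_index d I) (diag_part (cp_operator d r B)) \<and>
         spectral_norm (multi_index d I)
           (mat_diff (mat_inv (multi_index d I) (diag_part (cp_operator d r B)))
                     (E_star d r I B b k \<alpha> \<beta>))
         \<le> exp_sum_eps R k"
proof -
  define J where "J = multi_index d I"
  define D where "D = diag_part (cp_operator d r B)"
  define f where "f i = (\<Sum>\<nu>\<in>{1..r}. H_mat d B b \<nu> (i \<nu>) (i \<nu>))" for i
  have fin: "finite J" unfolding J_def using assms(4) by (rule finite_multi_index)
  have D: "diag_on J D f"
    unfolding D_def J_def f_def
    using diag_on_diag_part cp_operator_diagonal[where I = I, OF assms(3,7)]
    by (rule diag_on_cong)
  \<comment> \<open>Each \<open>f i\<close> is an eigenvalue, and the embedding of the reals into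
    the complex numbers is injective.\<close>
  have f: "f i \<in> one_to R" if "i \<in> J" for i
    using diag_on_spectrum[OF fin D that] assms(6) unfolding D_def J_def by auto
  then have nz: "f i \<noteq> 0" if "i \<in> J" for i
    using that by (force simp: one_to_def)
  have w: "(\<alpha>, \<beta>) \<in> pos_weights k" and eps: "exp_sum_error R k \<alpha> \<beta> = exp_sum_eps R k"
    using assms(8) by (auto simp: best_weights_def)
  \<comment> \<open>The error at the point 1 is an absolute value below the supremum, so the
    supremum is nonnegative, as the norm bound requires.\<close>
  have "1 \<in> one_to R" using assms(5) by (simp add: one_to_def one_ereal_def)
  from exp_sum_error_upper[OF w this] have "0 \<le> exp_sum_eps R k" unfolding eps by linarith
  moreover have "diag_on J (mat_diff (mat_inv J D) (E_star d r I B b k \<alpha> \<beta>))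
      (\<lambda>i. 1 / f i - exp_sum k \<alpha> \<beta> (f i))"
    unfolding f_def J_def
    using diag_on_mat_inv[OF fin D nz, unfolded f_def J_def] diag_on_E_star[OF assms(3,4)]
    by (rule diag_on_mat_diff)
  ultimately have "spectral_norm J (mat_diff (mat_inv J D) (E_star d r I B b k \<alpha> \<beta>))
      \<le> exp_sum_eps R k"
    \<comment> \<open>Each diagonal entry of the difference is the scalar error at the point
      \<open>f i\<close>, and for best weights the supremum of these errors is
      \<open>exp_sum_eps R k\<close>.\<close>
    using exp_sum_error_upper[OF w f] unfolding eps
    by (intro spectral_norm_diag_on_le[OF fin])
  with diag_on_invertible[OF fin D nz] show ?thesis
    unfolding J_def D_def by blast
qed

end
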